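(* Let $\Gamma$ be a loopless metric graph. Then the set $B(\Gamma)$ of branching points of $\Gamma$ is rank-determining; that is, for every divisor $D\in\mathrm{Div}(\Gamma)$ one has $r_\Gamma(D)=r_{B(\Gamma)}(D)$.
   Context: A metric graph $\Gamma$ is a finite connected multigraph in which each edge is assigned a positive (finite) real length; each edge is identified with a closed interval of that length, with the end points of the interval identified with the end vertices of the edge. It is loopless if no edge has coinciding end vertices (parallel edges are allowed). The points of $\Gamma$ are all points of these intervals. The vertices of the underlying multigraph are called branching points (vertices of degree two are allowed) and their set is denoted $B(\Gamma)$. $\mathrm{Div}(\Gamma)$ is the free abelian group on the set of points of $\Gamma$; a divisor $D=\sum_v D(v)(v)$ is effective ($D\ge0$) if $D(v)\ge 0$ for all $v$, and $\deg(D)=\sum_v D(v)$. For a set $A$ of points of $\Gamma$, $\mathrm{Div}(A)$ denotes the free abelian group on $A$, viewed as a subgroup of $\mathrm{Div}(\Gamma)$. A rational function on $\Gamma$ is a continuous function $f:\Gamma\to\mathbb R$ which is piecewise linear with finitely many pieces and integer slopes on every edge. For a point $v$, $\mathrm{ord}_v(f)$ is the sum of the outgoing slopes of $f$ over all segments emanating from $v$, and $\mathrm{div}(f)=\sum_v\mathrm{ord}_v(f)(v)$. Divisors $D,D'$ are equivalent, $D\sim D'$, if $D=D'+\mathrm{div}(f)$ for some rational function $f$. Put $|D|=\{E\in\mathrm{Div}(\Gamma):E\ge0,\ E\sim D\}$. The rank of $D$ is $$r_\Gamma(D)=\min\{\deg(E):E\in\mathrm{Div}(\Gamma),\ E\ge0,\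 |D-E|=\emptyset\}-1,$$ and, for a non-empty set $A$ of points of $\Gamma$, the $A$-restricted rank of $D$ is $$r_A(D)=\min\{\deg(E):E\in\mathrm{Div}(A),\ E\ge0,\ |D-E|=\emptyset\}-1.$$ The set $A$ is rank-determining if $r_\Gamma(D)=r_A(D)$ for every $D\in\mathrm{Div}(\Gamma)$. *)

theory Defs
  imports
    Complex_Main
    "HOL-Library.Poly_Mapping"
    "HOL-Algebra.Free_Abelian_Groups"
    "Graph_Theory.Digraph_Component"
begin

text \<open>
  The underlying multigraph is a finite \<^typ>\<open>('a, 'b) pre_digraph\<close>: an arc is an edge together with
  an arbitrary choice of orientation, which serves only to parametrise the edge \<open>e\<close> by the
  interval \<open>[0, len e]\<close> from its tail to its head. The constant
  \<^const>\<open>Digraph_Component.connected\<close> is connectedness of the underlying undirected graph and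
  includes that there is at least one vertex.
\<close>

locale metric_graph = fin_digraph G for G :: "('a, 'b) pre_digraph" +
  fixes len :: "'b \<Rightarrow> real"
  assumes connected_graph: "Digraph_Component.connected G"
    and len_pos: "e \<in> arcs G \<Longrightarrow> 0 < len e"

locale loopless_metric_graph = metric_graph + loopfree_digraph G

text \<open>
  The quotient of the disjoint union of the intervals by the identification of end points with
  vertices is represented by canonical representatives: \<open>Inner e t\<close> is the point at distance \<open>t\<close>
  from the tail of \<open>e\<close> along \<open>e\<close>, used only for \<open>0 < t < len e\<close>.
\<close>

datatype ('a, 'b) point = Vertex 'a | Inner 'b real

type_synonym 'p divisor = "'p \<Rightarrow>\<^sub>0 int"

definition Div :: "'p set \<Rightarrow> 'p divisor set" where
  "Div A = carrier (free_Abelian_group A)"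

definition effective :: "'p divisor \<Rightarrow> bool" where
  "effective D \<longleftrightarrow> (\<forall>v. 0 \<le> Poly_Mapping.lookup D v)"

definition degree :: "'p divisor \<Rightarrow> int" where
  "degree D = (\<Sum>v\<in>Poly_Mapping.keys D. Poly_Mapping.lookup D v)"

definition pl_integer_slopes :: "real \<Rightarrow> (real \<Rightarrow> real) \<Rightarrow> bool" where
  "pl_integer_slopes L g \<longleftrightarrow>
     (\<exists>(n::nat) p. p 0 = 0 \<and> p n = L \<and>
        (\<forall>i<n. p i < p (Suc i) \<and>
           (\<exists>(m::int) (c::real). \<forall>t\<in>{p i..p (Suc i)}. g t = of_int m * t + c)))"

text \<open>
  The slope at \<open>0\<close> to the right; well defined whenever \<open>g\<close> is affine with an integer slope on
  some \<open>[0, \<epsilon>]\<close>, see \<open>initial_slope_eqI\<close> below.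
\<close>

definition initial_slope :: "(real \<Rightarrow> real) \<Rightarrow> int" where
  "initial_slope g = (THE m. \<forall>\<^sub>F s in at_right 0. g s = g 0 + of_int m * s)"

context metric_graph
begin

definition points :: "('a, 'b) point set" where
  "points = Vertex ` verts G \<union> {Inner e t |e t. e \<in> arcs G \<and> 0 < t \<and> t < len e}"

definition branching_points :: "('a, 'b) point set" where
  "branching_points = Vertex ` verts G"

text \<open>The parametrisation of the edge \<open>e\<close> by \<open>t \<in> [0, len e]\<close>.\<close>

definition on_edge :: "'b \<Rightarrow> real \<Rightarrow> ('a, 'b) point" where
  "on_edge e t =
     (if t = 0 then Vertex (tail G e) else if t = len e then Vertex (head G e) else Inner e t)"

text \<open>
  Continuity for the quotient topology amounts to continuity along each edge. Functions are total
  on the type of points; their values outside of \<^const>\<open>points\<close> are irrelevant.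
\<close>

definition rational_function :: "(('a, 'b) point \<Rightarrow> real) \<Rightarrow> bool" where
  "rational_function f \<longleftrightarrow>
     (\<forall>e\<in>arcs G. continuous_on {0..len e} (\<lambda>t. f (on_edge e t)) \<and>
                 pl_integer_slopes (len e) (\<lambda>t. f (on_edge e t)))"

text \<open>The slope of \<open>f\<close> when leaving \<open>on_edge e t\<close> along \<open>e\<close> towards its head, respectively its tail.\<close>

definition slope_to_head :: "(('a, 'b) point \<Rightarrow> real) \<Rightarrow> 'b \<Rightarrow> real \<Rightarrow> int" where
  "slope_to_head f e t = initial_slope (\<lambda>s. f (on_edge e (t + s)))"

definition slope_to_tail :: "(('a, 'b) point \<Rightarrow> real) \<Rightarrow> 'b \<Rightarrow> real \<Rightarrow> int" where
  "slope_to_tail f e t = initial_slope (\<lambda>s. f (on_edge e (t - s)))"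

primrec ord_at :: "('a, 'b) point \<Rightarrow> (('a, 'b) point \<Rightarrow> real) \<Rightarrow> int" where
  "ord_at (Vertex v) f =
     (\<Sum>e\<in>out_arcs G v. slope_to_head f e 0) + (\<Sum>e\<in>in_arcs G v. slope_to_tail f e (len e))"
| "ord_at (Inner e t) f = slope_to_head f e t + slope_to_tail f e t"

text \<open>
  The argument of \<^const>\<open>Abs_poly_mapping\<close> has finite support for every rational function \<open>f\<close>,
  see \<open>lookup_divisor_of\<close> below.
\<close>

definition divisor_of :: "(('a, 'b) point \<Rightarrow> real) \<Rightarrow> ('a, 'b) point divisor" where
  "divisor_of f = Abs_poly_mapping (\<lambda>v. if v \<in> points then ord_at v f else 0)"

definition equivalent :: "('a, 'b) point divisor \<Rightarrow> ('a, 'b) point divisor \<Rightarrow> bool" where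
  "equivalent D D' \<longleftrightarrow> (\<exists>f. rational_function f \<and> D = D' + divisor_of f)"

definition linear_system :: "('a, 'b) point divisor \<Rightarrow> ('a, 'b) point divisor set" where
  "linear_system D = {E \<in> Div points. effective E \<and> equivalent E D}"

definition restricted_rank :: "('a, 'b) point set \<Rightarrow> ('a, 'b) point divisor \<Rightarrow> int" where
  "restricted_rank A D =
     (LEAST k. k \<in> {degree E |E. E \<in> Div A \<and> effective E \<and> linear_system (D - E) = {}}) - 1"

definition rank :: "('a, 'b) point divisor \<Rightarrow> int" where
  "rank D =
     (LEAST k. k \<in> {degree E |E. E \<in> Div points \<and> effective E \<and> linear_system (D - E) = {}}) - 1"

definition rank_determining :: "('a, 'b) point set \<Rightarrow> bool" where
  "rank_determining A \<longleftrightarrow>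
     A \<noteq> {} \<and> A \<subseteq> points \<and> (\<forall>D\<in>Div points. rank D = restricted_rank A D)"

end


lemma initial_slope_eqI:
  assumes "0 < \<epsilon>" and aff: "\<And>s. 0 \<le> s \<Longrightarrow> s \<le> \<epsilon> \<Longrightarrow> g s = of_int m * s + c"
  shows "initial_slope g = m"
  unfolding initial_slope_def
proof (rule the_equality)
  have g0: "g 0 = c"
    using aff[of 0] assms(1) by simp
  have ev: "\<forall>\<^sub>F s in at_right 0. 0 < s \<and> s < \<epsilon>"
    using assms(1) by (auto simp: eventually_at_right_field)
  then show m: "\<forall>\<^sub>F s in at_right 0. g s = g 0 + of_int m * s"
    by eventually_elim (use aff g0 in auto)
  fix m' :: int
  assume "\<forall>\<^sub>F s in at_right 0. g s = g 0 + of_int m' * s"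
  with m ev have "\<forall>\<^sub>F s in at_right (0::real). m' = m"
    by eventually_elim auto
  then show "m' = m"
    by simp
qed

lemma between_breakpoints:
  fixes p :: "nat \<Rightarrow> real"
  assumes "p 0 < t" "t < p n" "t \<notin> p ` {..n}"
  shows "\<exists>i<n. p i < t \<and> t < p (Suc i)"
  using assms
proof (induction n)
  case (Suc n)
  show ?case
  proof (cases "t < p n")
    case True
    have "t \<notin> p ` {..n}"
      using Suc.prems(3) by auto
    with Suc True show ?thesis
      using less_SucI by blast
  next
    case False
    with Suc.prems show ?thesis
      by (intro exI[of _ n]) (auto simp: order_less_le)
  qed
qed simp

context metric_graph
begin

lemma finite_ord_at_nonzero:
  assumes f: "rational_function f"
  shows "finite {v. (if v \<in> points then ord_at v f else 0) \<noteq> 0}"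
proof -
  have "\<forall>e\<in>arcs G. \<exists>S. finite S \<and> (\<forall>t. 0 < t \<and> t < len e \<and> t \<notin> S \<longrightarrow> ord_at (Inner e t) f = 0)"
  proof
    fix e assume "e \<in> arcs G"
    then have "pl_integer_slopes (len e) (\<lambda>t. f (on_edge e t))"
      using f by (simp add: rational_function_def)
    then obtain n :: nat and p where p: "p 0 = 0" "p n = len e"
      "\<And>i. i < n \<Longrightarrow> \<exists>(m::int) (c::real). \<forall>t\<in>{p i..p (Suc i)}. f (on_edge e t) = of_int m * t + c"
      unfolding pl_integer_slopes_def by (elim exE conjE) simp
    have "ord_at (Inner e t) f = 0" if t: "0 < t" "t < len e" "t \<notin> p ` {..n}" for t
    proof -
      obtain i where i: "i < n" "p i < t" "t < p (Suc i)"
        using between_breakpoints[of p t n] t p by auto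
      obtain m :: int and c :: real
        where mc: "\<And>t. p i \<le> t \<Longrightarrow> t \<le> p (Suc i) \<Longrightarrow> f (on_edge e t) = of_int m * t + c"
        using p(3)[OF i(1)] by auto
      have "slope_to_head f e t = m"
        unfolding slope_to_head_def
      proof (rule initial_slope_eqI)
        show "0 < p (Suc i) - t"
          using i(3) by simp
        show "f (on_edge e (t + s)) = of_int m * s + (of_int m * t + c)"
          if "0 \<le> s" "s \<le> p (Suc i) - t" for s
          using mc[of "t + s"] i(2) that by (simp add: algebra_simps)
      qed
      moreover have "slope_to_tail f e t = - m"
        unfolding slope_to_tail_def
      proof (rule initial_slope_eqI)
        show "0 < t - p i"
          using i(2) by simp
        show "f (on_edge e (t - s)) = of_int (- m) * s + (of_int m * t + c)"
          if "0 \<le> s" "s \<le> t - p i" for s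
          using mc[of "t - s"] i(3) that by (simp add: algebra_simps)
      qed
      ultimately show ?thesis
        by simp
    qed
    then show "\<exists>S. finite S \<and> (\<forall>t. 0 < t \<and> t < len e \<and> t \<notin> S \<longrightarrow> ord_at (Inner e t) f = 0)"
      by (intro exI[of _ "p ` {..n}"]) auto
  qed
  from bchoice[OF this] obtain S where S: "\<And>e. e \<in> arcs G \<Longrightarrow> finite (S e)"
    "\<And>e t. e \<in> arcs G \<Longrightarrow> 0 < t \<Longrightarrow> t < len e \<Longrightarrow> t \<notin> S e \<Longrightarrow> ord_at (Inner e t) f = 0"
    by auto
  have "{v. (if v \<in> points then ord_at v f else 0) \<noteq> 0} \<subseteq>
      Vertex ` verts G \<union> (\<Union>e\<in>arcs G. Inner e ` S e)"
  proof
    fix v assume "v \<in> {v. (if v \<in> points then ord_at v f else 0) \<noteq> 0}"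
    then have v: "v \<in> points" "ord_at v f \<noteq> 0"
      by (auto simp del: ord_at.simps split: if_splits)
    show "v \<in> Vertex ` verts G \<union> (\<Union>e\<in>arcs G. Inner e ` S e)"
    proof (cases v)
      case (Vertex w)
      with v(1) show ?thesis
        by (auto simp: points_def)
    next
      case (Inner e t)
      with v(1) have e: "e \<in> arcs G" and t: "0 < t" "t < len e"
        by (auto simp: points_def)
      have "t \<in> S e"
        using S(2)[OF e t] v(2) Inner by (auto simp del: ord_at.simps)
      with e Inner show ?thesis
        by auto
    qed
  qed
  moreover have "finite (Vertex ` verts G \<union> (\<Union>e\<in>arcs G. Inner e ` S e))"
    using S(1) by auto
  ultimately show ?thesis
    by (rule finite_subset)
qed

lemma lookup_divisor_of:
  assumes "rational_function f"
  shows "Poly_Mapping.lookup (divisor_of f) v = (if v \<in> points then ord_at v f else 0)"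
  unfolding divisor_of_def using finite_ord_at_nonzero[OF assms] by simp

end

end

theory Submission
  imports Defs
begin

text \<open>
  It suffices to show, for an edge \<open>e\<close> from \<open>u\<close> to \<open>w\<close> and an inner point \<open>x\<close> of \<open>e\<close>, that
  \<open>|D - x|\<close> is non-empty whenever \<open>|D - u|\<close> and \<open>|D - w|\<close> are: the inner points of an effective
  divisor can then be replaced by vertices one at a time. Let \<open>f\<^sub>u\<close> and \<open>f\<^sub>w\<close> witness the two
  hypotheses, normalised to vanish at \<open>x\<close>, and let \<open>g = max f\<^sub>u f\<^sub>w\<close>. Then \<open>D + div g\<close> is effective.
  Suppose that it has no chip at \<open>x\<close>. If it had no chip on the part of \<open>e\<close> from \<open>u\<close> to \<open>x\<close> either,
  then \<open>f\<^sub>u\<close> and \<open>g\<close>, which agree at \<open>x\<close>, would agree up to \<open>u\<close> by a maximum principle, and \<open>D + div g\<close>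
  would have at least as many chips at \<open>u\<close> as \<open>D + div f\<^sub>u\<close>. So there is a chip on either side
  of \<open>x\<close>; as \<open>e\<close> is not a loop, these are two different points, and firing the complement of the
  segment between them moves a chip to \<open>x\<close>.
\<close>

subsection \<open>Piecewise linear functions on an interval\<close>

text \<open>A relation in place of the definite description in \<open>initial_slope\<close>:
  existence of a slope can be carried through sums and maxima, and \<open>initial_slope_eq\<close>
  recovers the value.\<close>

definition has_initial_slope :: "(real \<Rightarrow> real) \<Rightarrow> int \<Rightarrow> bool" where
  "has_initial_slope g m \<longleftrightarrow> (\<forall>\<^sub>F s in at_right 0. g s = g 0 + of_int m * s)"

lemma has_initial_slopeI:
  assumes "0 < \<epsilon>" "\<And>s. 0 \<le> s \<Longrightarrow> s < \<epsilon> \<Longrightarrow> g s = g 0 + of_int m * s"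
  shows "has_initial_slope g m"
  unfolding has_initial_slope_def eventually_at_right_field
  using assms by (meson less_imp_le)

lemma has_initial_slopeE:
  assumes "has_initial_slope g m"
  obtains \<epsilon> where "0 < \<epsilon>" "\<And>s. 0 \<le> s \<Longrightarrow> s \<le> \<epsilon> \<Longrightarrow> g s = g 0 + of_int m * s"
proof -
  obtain b where b: "b > 0" "\<And>y. y > 0 \<Longrightarrow> y < b \<Longrightarrow> g y = g 0 + of_int m * y"
    using assms unfolding has_initial_slope_def eventually_at_right_field by auto
  show thesis
  proof
    show "0 < b / 2" using b by simp
    show "g s = g 0 + of_int m * s" if "0 \<le> s" "s \<le> b / 2" for s
      using b(2)[of s] b(1) that by (cases "s = 0") simp_all
  qed
qed

lemma initial_slope_eq:
  assumes "has_initial_slope g m"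
  shows "initial_slope g = m"
proof -
  obtain \<epsilon> where "0 < \<epsilon>" "\<And>s. 0 \<le> s \<Longrightarrow> s \<le> \<epsilon> \<Longrightarrow> g s = g 0 + of_int m * s"
    using has_initial_slopeE[OF assms] by blast
  then show ?thesis
    by (metis initial_slope_eqI add.commute)
qed

text \<open>The inequality of slopes does not depend on \<open>s\<close>. As the filter
  \<open>at_right 0\<close> is nontrivial, it is enough to obtain it for all small positive
  \<open>s\<close>, where the common value at \<open>0\<close> cancels.\<close>

lemma has_initial_slope_mono:
  assumes "has_initial_slope f m" "has_initial_slope g n"
    and "f 0 = g 0" "\<forall>\<^sub>F s in at_right 0. f s \<le> g s"
  shows "m \<le> n"
proof -
  have "\<forall>\<^sub>F s in at_right (0::real). m \<le> n"
    using assms(1)[unfolded has_initial_slope_def] assms(2)[unfolded has_initial_slope_def]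
      assms(4) eventually_at_right_less[of 0]
    by eventually_elim (use assms(3) in auto)
  then show ?thesis by simp
qed

lemma has_initial_slope_cong:
  assumes "has_initial_slope f m" "f 0 = g 0" "\<forall>\<^sub>F s in at_right 0. f s = g s"
  shows "has_initial_slope g m"
  using assms(1,3) unfolding has_initial_slope_def
  by eventually_elim (use assms(2) in auto)

lemma has_initial_slope_affine: "has_initial_slope (\<lambda>s. c + of_int m * s) m"
  by (simp add: has_initial_slope_def)

lemma has_initial_slope_add:
  assumes "has_initial_slope f m" "has_initial_slope g n"
  shows "has_initial_slope (\<lambda>s. f s + g s) (m + n)"
  using assms unfolding has_initial_slope_def
  by eventually_elim (simp add: algebra_simps)

lemma has_initial_slope_minus:
  assumes "has_initial_slope f m"
  shows "has_initial_slope (\<lambda>s. - f s) (- m)"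
  using assms unfolding has_initial_slope_def by eventually_elim simp

lemma has_initial_slope_tendsto:
  assumes "has_initial_slope f m"
  shows "(f \<longlongrightarrow> f 0) (at_right 0)"
proof -
  have "((\<lambda>s. f 0 + of_int m * s) \<longlongrightarrow> f 0 + of_int m * 0) (at_right 0)"
    by (intro tendsto_intros)
  moreover have "\<forall>\<^sub>F s in at_right 0. f 0 + of_int m * s = f s"
    using assms unfolding has_initial_slope_def by eventually_elim simp
  ultimately show ?thesis
    using Lim_transform_eventually by fastforce
qed

lemma has_initial_slope_eventually_less:
  assumes "has_initial_slope f m" "has_initial_slope g n" "f 0 < g 0"
  shows "\<forall>\<^sub>F s in at_right 0. f s < g s"
proof -
  obtain c where c: "f 0 < c" "c < g 0"
    using dense assms(3) by blast
  show ?thesis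
    using order_tendstoD(2)[OF has_initial_slope_tendsto[OF assms(1)] c(1)]
      order_tendstoD(1)[OF has_initial_slope_tendsto[OF assms(2)] c(2)]
    by eventually_elim simp
qed

text \<open>Off a tie, continuity makes the larger function the maximum near \<open>0\<close>. At a
  tie, of two lines through one point the one of greater slope is on top for
  \<open>s > 0\<close>.\<close>

lemma has_initial_slope_max_exists:
  assumes f: "has_initial_slope f m" and g: "has_initial_slope g n"
  shows "\<exists>k. has_initial_slope (\<lambda>s. max (f s) (g s)) k"
proof (cases "f 0" "g 0" rule: linorder_cases)
  case less
  have "\<forall>\<^sub>F s in at_right 0. g s = max (f s) (g s)"
    using has_initial_slope_eventually_less[OF f g less] by eventually_elim simp
  then have "has_initial_slope (\<lambda>s. max (f s) (g s)) n"
    using less by (intro has_initial_slope_cong[OF g]) auto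
  then show ?thesis ..
next
  case greater
  have "\<forall>\<^sub>F s in at_right 0. f s = max (f s) (g s)"
    using has_initial_slope_eventually_less[OF g f greater] by eventually_elim simp
  then have "has_initial_slope (\<lambda>s. max (f s) (g s)) m"
    using greater by (intro has_initial_slope_cong[OF f]) auto
  then show ?thesis ..
next
  case equal
  have "has_initial_slope (\<lambda>s. max (f s) (g s)) (max m n)"
    using f g eventually_at_right_less[of 0] unfolding has_initial_slope_def
  proof eventually_elim
    case (elim s)
    then show ?case using equal
      by (cases "m \<le> n") (auto simp: max_def)
  qed
  then show ?thesis ..
qed

text \<open>One-sided germs replace breakpoints. Closure under sums and maxima then takes no common
  refinement of subdivisions and no insertion of crossing points.\<close>

definition locally_pl :: "real \<Rightarrow> (real \<Rightarrow> real) \<Rightarrow> bool" where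
  "locally_pl L g \<longleftrightarrow>
     (\<forall>t. 0 \<le> t \<longrightarrow> t < L \<longrightarrow> (\<exists>m. has_initial_slope (\<lambda>s. g (t + s)) m)) \<and>
     (\<forall>t. 0 < t \<longrightarrow> t \<le> L \<longrightarrow> (\<exists>m. has_initial_slope (\<lambda>s. g (t - s)) m))"

lemma breakpoint_interval:
  fixes p :: "nat \<Rightarrow> real"
  shows "p 0 \<le> t \<Longrightarrow> t < p n \<Longrightarrow> \<exists>i<n. p i \<le> t \<and> t < p (Suc i)"
    and "p 0 < t \<Longrightarrow> t \<le> p n \<Longrightarrow> \<exists>i<n. p i < t \<and> t \<le> p (Suc i)"
proof (induction n)
  case (Suc n)
  {
    case 1
    then show ?case using Suc.IH(1) by (cases "t < p n") (auto intro: less_SucI)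
  next
    case 2
    then show ?case using Suc.IH(2) by (cases "t \<le> p n") (auto intro: less_SucI)
  }
qed auto

lemma pl_integer_slopes_imp_locally_pl:
  assumes "pl_integer_slopes L g"
  shows "locally_pl L g"
proof -
  obtain n :: nat and p where p: "p 0 = 0" "p n = L"
    "\<And>i. i < n \<Longrightarrow> \<exists>(m::int) (c::real). \<forall>t\<in>{p i..p (Suc i)}. g t = of_int m * t + c"
    using assms unfolding pl_integer_slopes_def by (elim exE conjE) simp
  show ?thesis
    unfolding locally_pl_def
  proof (intro conjI allI impI)
    fix t assume t: "0 \<le> t" "t < L"
    then obtain i where i: "i < n" "p i \<le> t" "t < p (Suc i)"
      using breakpoint_interval(1)[of p t n] p by auto
    obtain m :: int and c :: real
      where mc: "\<And>t. p i \<le> t \<Longrightarrow> t \<le> p (Suc i) \<Longrightarrow> g t = of_int m * t + c"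
      using p(3)[OF i(1)] by auto
    have "has_initial_slope (\<lambda>s. g (t + s)) m"
      using i mc by (intro has_initial_slopeI[of "p (Suc i) - t"]) (auto simp: algebra_simps)
    then show "\<exists>m. has_initial_slope (\<lambda>s. g (t + s)) m" ..
  next
    fix t assume t: "0 < t" "t \<le> L"
    then obtain i where i: "i < n" "p i < t" "t \<le> p (Suc i)"
      using breakpoint_interval(2)[of p t n] p by auto
    obtain m :: int and c :: real
      where mc: "\<And>t. p i \<le> t \<Longrightarrow> t \<le> p (Suc i) \<Longrightarrow> g t = of_int m * t + c"
      using p(3)[OF i(1)] by auto
    have "has_initial_slope (\<lambda>s. g (t - s)) (- m)"
      using i mc by (intro has_initial_slopeI[of "t - p i"]) (auto simp: algebra_simps)
    then show "\<exists>m. has_initial_slope (\<lambda>s. g (t - s)) m" ..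
  qed
qed

lemma pl_integer_slopes_extend:
  assumes "pl_integer_slopes c g" "c < d"
    and "\<And>t. c \<le> t \<Longrightarrow> t \<le> d \<Longrightarrow> g t = of_int m * t + k"
  shows "pl_integer_slopes d g"
proof -
  obtain n :: nat and p where p: "p 0 = 0" "p n = c"
    "\<forall>i<n. p i < p (Suc i) \<and>
       (\<exists>(m::int) (c::real). \<forall>t\<in>{p i..p (Suc i)}. g t = of_int m * t + c)"
    using assms(1) unfolding pl_integer_slopes_def by blast
  have "\<exists>(m'::int) (k'::real). \<forall>t\<in>{c..d}. g t = of_int m' * t + k'"
    using assms(3) by (intro exI[of _ m] exI[of _ k]) auto
  then show ?thesis
    unfolding pl_integer_slopes_def using p assms(2)
    by (intro exI[of _ "Suc n"] exI[of _ "p(Suc n := d)"]) (auto simp: less_Suc_eq)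
qed

text \<open>Compactness of \<open>[0, L]\<close> in the form of a supremum argument: subdivisions of
  initial segments can be pushed on until they reach \<open>L\<close>.\<close>

lemma locally_pl_imp_pl_integer_slopes:
  assumes L: "0 < L" and g: "locally_pl L g"
  shows "pl_integer_slopes L g"
proof -
  define T where "T = {c. 0 \<le> c \<and> c \<le> L \<and> pl_integer_slopes c g}"
  have T0: "0 \<in> T"
    using L by (auto simp: T_def pl_integer_slopes_def intro: exI[of _ "0::nat"])
  have bdd: "bdd_above T"
    by (auto simp: T_def intro: bdd_aboveI)
  define u where "u = Sup T"
  have u0: "0 \<le> u" and uL: "u \<le> L"
    using T0 bdd unfolding u_def by (auto simp: T_def intro: cSup_upper cSup_least)
  \<comment> \<open>The supremum is attained: the left germ at \<open>u\<close> is affine on a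
    segment that contains some \<open>c\<close> of \<open>T\<close>, so one more piece leads from
    \<open>c\<close> to \<open>u\<close>.\<close>
  have uT: "u \<in> T"
  proof (cases "u = 0")
    case False
    then obtain m where "has_initial_slope (\<lambda>s. g (u - s)) m"
      using g u0 uL unfolding locally_pl_def by force
    then obtain \<epsilon> where \<epsilon>: "0 < \<epsilon>"
      "\<And>s. 0 \<le> s \<Longrightarrow> s \<le> \<epsilon> \<Longrightarrow> g (u - s) = g u + of_int m * s"
      by (rule has_initial_slopeE) simp
    obtain c where c: "c \<in> T" "u - \<epsilon> < c"
      using less_cSup_iff[of T "u - \<epsilon>"] T0 bdd \<epsilon>(1) by (auto simp: u_def)
    have cu: "c \<le> u"
      using c(1) bdd by (auto simp: u_def intro: cSup_upper)
    show ?thesis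
    proof (cases "c = u")
      case False
      have "pl_integer_slopes u g"
      proof (rule pl_integer_slopes_extend[of c])
        show "g t = of_int (- m) * t + (g u + of_int m * u)" if "c \<le> t" "t \<le> u" for t
          using \<epsilon>(2)[of "u - t"] that c by (simp add: algebra_simps)
      qed (use c cu False in \<open>auto simp: T_def\<close>)
      then show ?thesis using u0 uL by (simp add: T_def)
    qed (use c in simp)
  qed (use T0 in simp)
  \<comment> \<open>Otherwise the right germ at \<open>u\<close> yields a further piece, and
    \<open>u\<close> is not an upper bound of \<open>T\<close>.\<close>
  have "u = L"
  proof (rule ccontr)
    assume "u \<noteq> L"
    then obtain m where "has_initial_slope (\<lambda>s. g (u + s)) m"
      using g u0 uL unfolding locally_pl_def by force
    then obtain \<epsilon> where \<epsilon>: "0 < \<epsilon>"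
      "\<And>s. 0 \<le> s \<Longrightarrow> s \<le> \<epsilon> \<Longrightarrow> g (u + s) = g u + of_int m * s"
      by (rule has_initial_slopeE) simp
    define d where "d = min L (u + \<epsilon>)"
    have d: "u < d" "d \<le> L" "d \<le> u + \<epsilon>"
      using \<open>u \<noteq> L\<close> uL \<epsilon>(1) by (auto simp: d_def)
    have "pl_integer_slopes d g"
    proof (rule pl_integer_slopes_extend[of u])
      show "g t = of_int m * t + (g u - of_int m * u)" if "u \<le> t" "t \<le> d" for t
        using \<epsilon>(2)[of "t - u"] that d by (simp add: algebra_simps)
    qed (use uT d in \<open>auto simp: T_def\<close>)
    then have "d \<in> T" using d u0 by (simp add: T_def)
    then have "d \<le> u" using bdd by (auto simp: u_def intro: cSup_upper)
    with d show False by simp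
  qed
  with uT show ?thesis by (simp add: T_def)
qed

lemma pl_integer_slopes_iff_locally_pl:
  "0 < L \<Longrightarrow> pl_integer_slopes L g \<longleftrightarrow> locally_pl L g"
  using pl_integer_slopes_imp_locally_pl locally_pl_imp_pl_integer_slopes by blast

lemma locally_pl_max:
  "locally_pl L f \<Longrightarrow> locally_pl L g \<Longrightarrow> locally_pl L (\<lambda>t. max (f t) (g t))"
  unfolding locally_pl_def by (fast intro: has_initial_slope_max_exists)

lemma locally_pl_add:
  "locally_pl L f \<Longrightarrow> locally_pl L g \<Longrightarrow> locally_pl L (\<lambda>t. f t + g t)"
  unfolding locally_pl_def by (fast intro: has_initial_slope_add)

lemma locally_pl_minus:
  "locally_pl L f \<Longrightarrow> locally_pl L (\<lambda>t. - f t)"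
  unfolding locally_pl_def by (fast intro: has_initial_slope_minus)

lemma locally_pl_affine: "locally_pl L (\<lambda>t. c + of_int m * t)"
proof -
  have "has_initial_slope (\<lambda>s. c + of_int m * (t + s)) m" for t
    using has_initial_slope_affine[of "c + of_int m * t" m] by (simp add: algebra_simps)
  moreover have "has_initial_slope (\<lambda>s. c + of_int m * (t - s)) (- m)" for t
    using has_initial_slope_affine[of "c + of_int m * t" "- m"] by (simp add: algebra_simps)
  ultimately show ?thesis unfolding locally_pl_def by blast
qed

lemma locally_pl_min:
  assumes "locally_pl L f" "locally_pl L g"
  shows "locally_pl L (\<lambda>t. min (f t) (g t))"
  using locally_pl_minus[OF locally_pl_max[OF locally_pl_minus[OF assms(1)] locally_pl_minus[OF assms(2)]]]
  by (simp add: minus_max_eq_min)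

lemma locally_pl_cong:
  assumes "locally_pl L f" "\<And>t. 0 \<le> t \<Longrightarrow> t \<le> L \<Longrightarrow> f t = g t"
  shows "locally_pl L g"
  unfolding locally_pl_def
proof (intro conjI allI impI)
  fix t assume t: "0 \<le> t" "t < L"
  then obtain m where m: "has_initial_slope (\<lambda>s. f (t + s)) m"
    using assms(1) unfolding locally_pl_def by blast
  have "\<forall>\<^sub>F s in at_right 0. f (t + s) = g (t + s)"
    unfolding eventually_at_right_field using t assms(2) by (intro exI[of _ "L - t"]) auto
  with m have "has_initial_slope (\<lambda>s. g (t + s)) m"
    using has_initial_slope_cong[of "\<lambda>s. f (t + s)" m "\<lambda>s. g (t + s)"] t assms(2) by simp
  then show "\<exists>m. has_initial_slope (\<lambda>s. g (t + s)) m" ..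
next
  fix t assume t: "0 < t" "t \<le> L"
  then obtain m where m: "has_initial_slope (\<lambda>s. f (t - s)) m"
    using assms(1) unfolding locally_pl_def by blast
  have "\<forall>\<^sub>F s in at_right 0. f (t - s) = g (t - s)"
    unfolding eventually_at_right_field using t assms(2) by (intro exI[of _ "t"]) auto
  with m have "has_initial_slope (\<lambda>s. g (t - s)) m"
    using has_initial_slope_cong[of "\<lambda>s. f (t - s)" m "\<lambda>s. g (t - s)"] t assms(2) by simp
  then show "\<exists>m. has_initial_slope (\<lambda>s. g (t - s)) m" ..
qed

subsection \<open>Orders of rational functions\<close>

context metric_graph
begin

lemma rational_function_iff:
  "rational_function f \<longleftrightarrow>
     (\<forall>e\<in>arcs G. continuous_on {0..len e} (\<lambda>t. f (on_edge e t)) \<and>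
                 locally_pl (len e) (\<lambda>t. f (on_edge e t)))"
  unfolding rational_function_def using pl_integer_slopes_iff_locally_pl len_pos by blast

lemma has_slope_to_head:
  assumes "rational_function f" "e \<in> arcs G" "0 \<le> t" "t < len e"
  shows "has_initial_slope (\<lambda>s. f (on_edge e (t + s))) (slope_to_head f e t)"
proof -
  obtain m where "has_initial_slope (\<lambda>s. f (on_edge e (t + s))) m"
    using assms unfolding rational_function_iff locally_pl_def by blast
  then show ?thesis using initial_slope_eq by (auto simp: slope_to_head_def)
qed

lemma has_slope_to_tail:
  assumes "rational_function f" "e \<in> arcs G" "0 < t" "t \<le> len e"
  shows "has_initial_slope (\<lambda>s. f (on_edge e (t - s))) (slope_to_tail f e t)"
proof -
  obtain m where "has_initial_slope (\<lambda>s. f (on_edge e (t - s))) m"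
    using assms unfolding rational_function_iff locally_pl_def by blast
  then show ?thesis using initial_slope_eq by (auto simp: slope_to_tail_def)
qed

lemma rational_function_max:
  "rational_function f \<Longrightarrow> rational_function g \<Longrightarrow> rational_function (\<lambda>p. max (f p) (g p))"
  unfolding rational_function_iff by (auto intro: continuous_on_max locally_pl_max)

lemma rational_function_add:
  "rational_function f \<Longrightarrow> rational_function g \<Longrightarrow> rational_function (\<lambda>p. f p + g p)"
  unfolding rational_function_iff by (auto intro: continuous_on_add locally_pl_add)

lemma rational_function_const: "rational_function (\<lambda>p. c)"
  unfolding rational_function_iff using locally_pl_affine[of _ c 0] by auto

section \<open>Comparison and additivity of slopes and orders\<close>

lemma slope_to_head_mono:
  assumes "rational_function f" "rational_function g" "e \<in> arcs G" "0 \<le> t" "t < len e"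
    and "f (on_edge e t) = g (on_edge e t)" "\<And>p. f p \<le> g p"
  shows "slope_to_head f e t \<le> slope_to_head g e t"
  using has_initial_slope_mono[OF has_slope_to_head[OF assms(1,3,4,5)] has_slope_to_head[OF assms(2,3,4,5)]]
    assms(6,7) by auto

lemma slope_to_tail_mono:
  assumes "rational_function f" "rational_function g" "e \<in> arcs G" "0 < t" "t \<le> len e"
    and "f (on_edge e t) = g (on_edge e t)" "\<And>p. f p \<le> g p"
  shows "slope_to_tail f e t \<le> slope_to_tail g e t"
  using has_initial_slope_mono[OF has_slope_to_tail[OF assms(1,3,4,5)] has_slope_to_tail[OF assms(2,3,4,5)]]
    assms(6,7) by auto

lemma on_edge_0 [simp]: "on_edge e 0 = Vertex (tail G e)"
  by (simp add: on_edge_def)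

lemma on_edge_len [simp]: "e \<in> arcs G \<Longrightarrow> on_edge e (len e) = Vertex (head G e)"
  using len_pos[of e] by (simp add: on_edge_def)

lemma on_edge_Inner: "0 < t \<Longrightarrow> t < len e \<Longrightarrow> on_edge e t = Inner e t"
  by (simp add: on_edge_def)

text \<open>Lifting a function while fixing its value at \<open>p\<close> can only raise each
  outgoing slope at \<open>p\<close>, and the order is the sum of these slopes.\<close>

lemma ord_at_mono:
  assumes f: "rational_function f" and g: "rational_function g"
    and p: "p \<in> points" "f p = g p" and le: "\<And>p. f p \<le> g p"
  shows "ord_at p f \<le> ord_at p g"
proof (cases p)
  case (Vertex v)
  have "(\<Sum>e\<in>out_arcs G v. slope_to_head f e 0) \<le> (\<Sum>e\<in>out_arcs G v. slope_to_head g e 0)"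
    using Vertex p by (intro sum_mono slope_to_head_mono f g le) (auto simp: len_pos)
  moreover have "(\<Sum>e\<in>in_arcs G v. slope_to_tail f e (len e)) \<le> (\<Sum>e\<in>in_arcs G v. slope_to_tail g e (len e))"
    using Vertex p by (intro sum_mono slope_to_tail_mono f g le) (auto simp: len_pos)
  ultimately show ?thesis using Vertex by simp
next
  case (Inner e t)
  with p have e: "e \<in> arcs G" "0 < t" "t < len e" by (auto simp: points_def)
  then show ?thesis
    using Inner p slope_to_head_mono[OF f g, of e t] slope_to_tail_mono[OF f g, of e t] le
    by (auto simp: on_edge_Inner intro!: add_mono)
qed

lemma slope_to_head_add:
  assumes "rational_function f" "rational_function g" "e \<in> arcs G" "0 \<le> t" "t < len e"
  shows "slope_to_head (\<lambda>p. f p + g p) e t = slope_to_head f e t + slope_to_head g e t"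
  unfolding slope_to_head_def[of "\<lambda>p. f p + g p"]
  using assms by (intro initial_slope_eq has_initial_slope_add has_slope_to_head)

lemma slope_to_tail_add:
  assumes "rational_function f" "rational_function g" "e \<in> arcs G" "0 < t" "t \<le> len e"
  shows "slope_to_tail (\<lambda>p. f p + g p) e t = slope_to_tail f e t + slope_to_tail g e t"
  unfolding slope_to_tail_def[of "\<lambda>p. f p + g p"]
  using assms by (intro initial_slope_eq has_initial_slope_add has_slope_to_tail)

lemma ord_at_add:
  assumes f: "rational_function f" and g: "rational_function g" and p: "p \<in> points"
  shows "ord_at p (\<lambda>p. f p + g p) = ord_at p f + ord_at p g"
proof (cases p)
  case (Vertex v)
  have "(\<Sum>e\<in>out_arcs G v. slope_to_head (\<lambda>p. f p + g p) e 0) =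
      (\<Sum>e\<in>out_arcs G v. slope_to_head f e 0) + (\<Sum>e\<in>out_arcs G v. slope_to_head g e 0)"
    unfolding sum.distrib[symmetric]
    by (intro sum.cong slope_to_head_add f g) (auto simp: len_pos)
  moreover have "(\<Sum>e\<in>in_arcs G v. slope_to_tail (\<lambda>p. f p + g p) e (len e)) =
      (\<Sum>e\<in>in_arcs G v. slope_to_tail f e (len e)) + (\<Sum>e\<in>in_arcs G v. slope_to_tail g e (len e))"
    unfolding sum.distrib[symmetric]
    by (intro sum.cong slope_to_tail_add f g) (auto simp: len_pos)
  ultimately show ?thesis using Vertex by simp
next
  case (Inner e t)
  with p have e: "e \<in> arcs G" "0 < t" "t < len e" by (auto simp: points_def)
  then show ?thesis
    using Inner by (simp add: slope_to_head_add[OF f g] slope_to_tail_add[OF f g])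
qed

lemma ord_at_const: "ord_at p (\<lambda>p. c) = 0"
proof -
  have "initial_slope (\<lambda>s. c) = 0"
    using initial_slope_eqI[of 1 "\<lambda>s. c" 0 c] by simp
  then show ?thesis
    by (cases p) (auto simp: slope_to_head_def slope_to_tail_def)
qed

text \<open>At every point the maximum touches one of the two functions from above. Hence
  \<open>D + div (max f g)\<close> is effective when \<open>D + div f\<close> and
  \<open>D + div g\<close> are.\<close>

lemma ord_at_max_ge:
  assumes "rational_function f" "rational_function g" "p \<in> points"
  shows "ord_at p f \<le> ord_at p (\<lambda>p. max (f p) (g p)) \<or> ord_at p g \<le> ord_at p (\<lambda>p. max (f p) (g p))"
  using ord_at_mono[OF assms(1) rational_function_max[OF assms(1,2)] assms(3)]
    ord_at_mono[OF assms(2) rational_function_max[OF assms(1,2)] assms(3)]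
  by (cases "f p \<le> g p") (auto simp: max_def)

lemma slope_to_head_eqI:
  assumes "has_initial_slope k m" "t < len e"
    and "\<And>s. 0 \<le> s \<Longrightarrow> s \<le> len e - t \<Longrightarrow> k s = f (on_edge e (t + s))"
  shows "slope_to_head f e t = m"
proof -
  have "\<forall>\<^sub>F s in at_right 0. k s = f (on_edge e (t + s))"
    unfolding eventually_at_right_field using assms(2,3) by (intro exI[of _ "len e - t"]) auto
  moreover have "k 0 = f (on_edge e (t + 0))"
    using assms(2,3) by (metis diff_ge_0_iff_ge less_imp_le order_refl)
  ultimately show ?thesis
    unfolding slope_to_head_def by (intro initial_slope_eq has_initial_slope_cong[OF assms(1)])
qed

lemma slope_to_tail_eqI:
  assumes "has_initial_slope k m" "0 < t"
    and "\<And>s. 0 \<le> s \<Longrightarrow> s \<le> t \<Longrightarrow> k s = f (on_edge e (t - s))"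
  shows "slope_to_tail f e t = m"
proof -
  have "\<forall>\<^sub>F s in at_right 0. k s = f (on_edge e (t - s))"
    unfolding eventually_at_right_field using assms(2,3) by (intro exI[of _ t]) auto
  moreover have "k 0 = f (on_edge e (t - 0))"
    using assms(2,3) by (metis less_imp_le order_refl)
  ultimately show ?thesis
    unfolding slope_to_tail_def by (intro initial_slope_eq has_initial_slope_cong[OF assms(1)])
qed

lemma on_edge_in_points:
  assumes "e \<in> arcs G" "0 \<le> t" "t \<le> len e"
  shows "on_edge e t \<in> points"
  using assms by (auto simp: points_def on_edge_def)

end

subsection \<open>Firing the complement of a segment\<close>

text \<open>Zero outside of \<open>[a, b]\<close>, with slopes \<open>-1\<close>, \<open>0\<close>, \<open>1\<close> and bottom value \<open>-d\<close> inside, if \<open>a + 2 * d \<le> b\<close>.\<close>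

definition trough :: "real \<Rightarrow> real \<Rightarrow> real \<Rightarrow> real \<Rightarrow> real" where
  "trough a b d t = max (- d) (min 0 (max (a - t) (t - b)))"

text \<open>Reflection turns left slopes into right slopes, so that a single case distinction serves
  both.\<close>

lemma trough_reflect: "trough a b d (- t) = trough (- b) (- a) d t"
  by (simp add: trough_def max.commute)

lemma has_initial_slope_trough_right:
  assumes "0 < d" "a + 2 * d \<le> b"
  shows "has_initial_slope (\<lambda>s. trough a b d (t + s))
    (if t < a then 0 else if t < a + d then - 1 else if t < b - d then 0 else if t < b then 1 else 0)"
proof -
  \<comment> \<open>The bottom piece from \<open>a + d\<close> to \<open>b - d\<close> is empty if
    \<open>a + 2 * d = b\<close>; the trough is then V-shaped.\<close>
  consider "t < a" | "a \<le> t" "t < a + d" | "a + d \<le> t" "t < b - d" | "b - d \<le> t" "t < b" | "b \<le> t"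
    by linarith
  then show ?thesis
  proof cases
    case 1
    then show ?thesis using assms
      by (intro has_initial_slopeI[of "a - t"]) (auto simp: trough_def)
  next
    case 2
    then show ?thesis using assms
      by (intro has_initial_slopeI[of "a + d - t"]) (auto simp: trough_def)
  next
    case 3
    then show ?thesis using assms
      by (intro has_initial_slopeI[of "b - d - t"]) (auto simp: trough_def)
  next
    case 4
    then show ?thesis using assms
      by (intro has_initial_slopeI[of "b - t"]) (auto simp: trough_def)
  next
    case 5
    then show ?thesis using assms
      by (intro has_initial_slopeI[of 1]) (auto simp: trough_def)
  qed
qed

lemma has_initial_slope_trough_left:
  assumes "0 < d" "a + 2 * d \<le> b"
  shows "has_initial_slope (\<lambda>s. trough a b d (t - s))
    (if b < t then 0 else if b - d < t then - 1 else if a + d < t then 0 else if a < t then 1 else 0)"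
proof -
  have "has_initial_slope (\<lambda>s. trough (- b) (- a) d (- t + s))
      (if - t < - b then 0 else if - t < - b + d then - 1 else if - t < - a - d then 0
       else if - t < - a then 1 else 0)"
    using assms by (intro has_initial_slope_trough_right) auto
  moreover have "trough (- b) (- a) d (- t + s) = trough a b d (t - s)" for s
    using trough_reflect[of a b d "- t + s"] by simp
  moreover have "- t < - b + d \<longleftrightarrow> b - d < t" "- t < - a - d \<longleftrightarrow> a + d < t"
    by linarith+
  ultimately show ?thesis
    by (simp only: neg_less_iff_less)
qed

lemma locally_pl_trough: "locally_pl L (trough a b d)"
proof -
  have 1: "locally_pl L (\<lambda>t. - d)" "locally_pl L (\<lambda>t. 0)"
    using locally_pl_affine[of L "- d" 0] locally_pl_affine[of L 0 0] by simp_all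
  have 2: "locally_pl L (\<lambda>t. a - t)" "locally_pl L (\<lambda>t. t - b)"
    using locally_pl_affine[of L a "- 1"] locally_pl_affine[of L "- b" 1] by simp_all
  have "locally_pl L (\<lambda>t. max (- d) (min 0 (max (a - t) (t - b))))"
    by (intro locally_pl_max locally_pl_min 1 2)
  then show ?thesis by (simp add: trough_def[abs_def])
qed

lemma continuous_on_trough: "continuous_on S (trough a b d)"
  unfolding trough_def by (intro continuous_intros)

context metric_graph
begin

text \<open>For \<open>0 \<le> a\<close> and \<open>b \<le> len e\<close>, the value 0 at vertices
  is the continuous one even at the ends of \<open>e\<close>, since the trough vanishes at
  \<open>a\<close>, at \<open>b\<close> and beyond.\<close>

definition edge_trough :: "'b \<Rightarrow> real \<Rightarrow> real \<Rightarrow> real \<Rightarrow> ('a, 'b) point \<Rightarrow> real" where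
  "edge_trough e a b d p =
     (case p of Vertex _ \<Rightarrow> 0 | Inner e' t \<Rightarrow> if e' = e then trough a b d t else 0)"

lemma edge_trough_on_edge:
  assumes "0 \<le> a" "b \<le> len e" "0 \<le> d" "0 \<le> t" "t \<le> len e'"
  shows "edge_trough e a b d (on_edge e' t) = (if e' = e then trough a b d t else 0)"
  using assms by (auto simp: edge_trough_def on_edge_def trough_def)

lemma rational_function_edge_trough:
  assumes "0 \<le> a" "b \<le> len e" "0 \<le> d"
  shows "rational_function (edge_trough e a b d)"
  unfolding rational_function_iff
proof (intro ballI conjI)
  fix e' assume "e' \<in> arcs G"
  note eq = edge_trough_on_edge[OF assms]
  show "continuous_on {0..len e'} (\<lambda>t. edge_trough e a b d (on_edge e' t))"
    using continuous_on_cong[of "{0..len e'}" "{0..len e'}" "\<lambda>t. edge_trough e a b d (on_edge e' t)"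
        "if e' = e then trough a b d else (\<lambda>_. 0)"]
    by (auto simp: eq continuous_on_trough)
  show "locally_pl (len e') (\<lambda>t. edge_trough e a b d (on_edge e' t))"
    by (rule locally_pl_cong[of _ "if e' = e then trough a b d else (\<lambda>_. 0)"])
      (use locally_pl_affine[of _ 0 0] in \<open>auto simp: eq locally_pl_trough\<close>)
qed

lemma slope_to_head_edge_trough:
  assumes "0 \<le> a" "b \<le> len e" "0 < d" "a + 2 * d \<le> b" "0 \<le> t" "t < len e'"
  shows "slope_to_head (edge_trough e a b d) e' t = (if e' = e then
    (if t < a then 0 else if t < a + d then - 1 else if t < b - d then 0 else if t < b then 1 else 0)
    else 0)"
proof (cases "e' = e")
  case True
  with assms show ?thesis
    using slope_to_head_eqI[OF has_initial_slope_trough_right[OF assms(3,4)], where t = t and e = e and f = "edge_trough e a b d"]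
    by (simp add: edge_trough_on_edge)
next
  case False
  have "has_initial_slope (\<lambda>s. 0) 0"
    using has_initial_slope_affine[of 0 0] by simp
  with assms False show ?thesis
    using slope_to_head_eqI[where k = "\<lambda>s. 0" and t = t and e = e' and f = "edge_trough e a b d"]
    by (simp add: edge_trough_on_edge)
qed

lemma slope_to_tail_edge_trough:
  assumes "0 \<le> a" "b \<le> len e" "0 < d" "a + 2 * d \<le> b" "0 < t" "t \<le> len e'"
  shows "slope_to_tail (edge_trough e a b d) e' t = (if e' = e then
    (if b < t then 0 else if b - d < t then - 1 else if a + d < t then 0 else if a < t then 1 else 0)
    else 0)"
proof (cases "e' = e")
  case True
  with assms show ?thesis
    using slope_to_tail_eqI[OF has_initial_slope_trough_left[OF assms(3,4)], where t = t and e = e and f = "edge_trough e a b d"]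
    by (simp add: edge_trough_on_edge)
next
  case False
  have "has_initial_slope (\<lambda>s. 0) 0"
    using has_initial_slope_affine[of 0 0] by simp
  with assms False show ?thesis
    using slope_to_tail_eqI[where k = "\<lambda>s. 0" and t = t and e = e' and f = "edge_trough e a b d"]
    by (simp add: edge_trough_on_edge)
qed

text \<open>Slope -1 leads into the segment from \<open>a\<close> and from \<open>b\<close>, so each
  end pays one chip; the bottom corners \<open>a + d\<close> and \<open>b - d\<close> receive one
  chip each, or two if they coincide. Counting one chip at the corner \<open>x\<close> alone gives
  an inequality that covers both cases.\<close>

lemma ord_at_edge_trough:
  assumes e: "e \<in> arcs G" and ab: "0 \<le> a" "b \<le> len e" "0 < d" "a + 2 * d \<le> b"
    and x: "x = a + d \<or> x = b - d" and p: "p \<in> points"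
  shows "of_bool (p = Inner e x) - of_bool (p = on_edge e a) - of_bool (p = on_edge e b)
    \<le> ord_at p (edge_trough e a b d)"
proof (cases p)
  case (Vertex v)
  have pos: "e' \<in> arcs G \<Longrightarrow> 0 < len e'" for e' by (rule len_pos)
  \<comment> \<open>Only \<open>e\<close> contributes, and only if the segment starts at its tail;
    otherwise the trough is flat there.\<close>
  have "(\<Sum>e'\<in>out_arcs G v. slope_to_head (edge_trough e a b d) e' 0) =
      (\<Sum>e'\<in>out_arcs G v. if e' = e then - of_bool (a = 0) else 0)"
    using ab pos by (intro sum.cong) (auto simp: slope_to_head_edge_trough)
  also have "\<dots> = (if tail G e = v then - of_bool (a = 0) else 0)"
    using e by (subst sum.delta) auto
  finally have out: "(\<Sum>e'\<in>out_arcs G v. slope_to_head (edge_trough e a b d) e' 0) = \<dots>" .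
  have "(\<Sum>e'\<in>in_arcs G v. slope_to_tail (edge_trough e a b d) e' (len e')) =
      (\<Sum>e'\<in>in_arcs G v. if e' = e then - of_bool (b = len e) else 0)"
    using ab pos by (intro sum.cong) (auto simp: slope_to_tail_edge_trough)
  also have "\<dots> = (if head G e = v then - of_bool (b = len e) else 0)"
    using e by (subst sum.delta) auto
  finally have "in": "(\<Sum>e'\<in>in_arcs G v. slope_to_tail (edge_trough e a b d) e' (len e')) = \<dots>" .
  have "a < b" using ab by simp
  then show ?thesis
    using Vertex ab e by (auto simp: out "in" on_edge_def)
next
  case (Inner e' t)
  with p have t: "0 < t" "t < len e'" by (auto simp: points_def)
  have "p = on_edge e a \<longleftrightarrow> e' = e \<and> t = a" "p = on_edge e b \<longleftrightarrow> e' = e \<and> t = b"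
    using Inner t ab by (auto simp: on_edge_def)
  then show ?thesis
    using Inner t ab x
    by (auto simp: slope_to_head_edge_trough slope_to_tail_edge_trough)
qed

end

subsection \<open>The maximum principle along an edge\<close>

text \<open>Real induction downwards from \<open>c\<close>. The supremum of the failures satisfies
  \<open>P\<close> by \<open>closed\<close>; then \<open>open\<close> keeps failures at a distance
  below it, which contradicts its being the supremum.\<close>

lemma interval_descent:
  fixes P :: "real \<Rightarrow> bool"
  assumes "0 \<le> c" "P c"
    and closed: "\<And>u. 0 \<le> u \<Longrightarrow> u < c \<Longrightarrow> (\<And>s. u < s \<Longrightarrow> s \<le> c \<Longrightarrow> P s) \<Longrightarrow> P u"
    and "open": "\<And>u. 0 < u \<Longrightarrow> u \<le> c \<Longrightarrow> P u \<Longrightarrow> \<exists>\<delta>>0. \<forall>s. u - \<delta> \<le> s \<longrightarrow> s \<le> u \<longrightarrow> P s"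
  shows "P 0"
proof (rule ccontr)
  assume "\<not> P 0"
  define S where "S = {t. 0 \<le> t \<and> t \<le> c \<and> \<not> P t}"
  have S: "0 \<in> S" "bdd_above S"
    using assms(1) \<open>\<not> P 0\<close> by (auto simp: S_def intro: bdd_aboveI)
  define u where "u = Sup S"
  have u: "0 \<le> u" "u \<le> c"
    using S unfolding u_def by (auto simp: S_def intro: cSup_upper cSup_least)
  have above: "P s" if "u < s" "s \<le> c" for s
  proof (rule ccontr)
    assume "\<not> P s"
    with that u have "s \<in> S" by (simp add: S_def)
    then have "s \<le> u" using S unfolding u_def by (intro cSup_upper)
    with that show False by simp
  qed
  have Pu: "P u"
    using closed[of u] above u assms(2) by (cases "u = c") auto
  then have "0 < u"
    using u \<open>\<not> P 0\<close> by (cases "u = 0") auto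
  then obtain \<delta> where \<delta>: "0 < \<delta>" "\<And>s. u - \<delta> \<le> s \<Longrightarrow> s \<le> u \<Longrightarrow> P s"
    using "open" u Pu by blast
  obtain s where "s \<in> S" "u - \<delta> < s"
    using less_cSup_iff[of S "u - \<delta>"] S \<delta>(1) by (auto simp: u_def)
  moreover have "s \<le> u"
    using S \<open>s \<in> S\<close> unfolding u_def by (intro cSup_upper)
  ultimately show False
    using \<delta>(2) by (auto simp: S_def)
qed

text \<open>A slope at \<open>0\<close> entails right continuity, so agreement on
  \<open>(0, c]\<close> passes to the limit. This supplies the hypothesis \<open>closed\<close> of
  \<open>interval_descent\<close>.\<close>

lemma has_initial_slope_eq_0:
  assumes "has_initial_slope f m" "has_initial_slope g n" "0 < c" "\<And>s. 0 < s \<Longrightarrow> s \<le> c \<Longrightarrow> f s = g s"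
  shows "f 0 = g 0"
proof -
  have "\<forall>\<^sub>F s in at_right 0. f s = g s"
    unfolding eventually_at_right_field using assms(3,4) by (intro exI[of _ c]) auto
  then have "(g \<longlongrightarrow> f 0) (at_right 0)"
    using Lim_transform_eventually has_initial_slope_tendsto[OF assms(1)] by blast
  then show ?thesis
    using has_initial_slope_tendsto[OF assms(2)] by (intro tendsto_unique) auto
qed

context metric_graph
begin

text \<open>
  Both summands of \<open>ord_at (Inner e t)\<close> are monotone at a contact point of \<open>f \<le> g\<close>, so the reverse
  inequality between the sums forces \<open>f\<close> and \<open>g\<close> to have the same slopes there.
\<close>

lemma contact_slopes_eq:
  assumes fg: "rational_function f" "rational_function g" "\<And>p. f p \<le> g p"
    and e: "e \<in> arcs G" and t: "0 < t" "t < len e"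
    and eq: "f (on_edge e t) = g (on_edge e t)"
    and ord: "ord_at (Inner e t) g \<le> ord_at (Inner e t) f"
  shows "slope_to_head f e t = slope_to_head g e t" "slope_to_tail f e t = slope_to_tail g e t"
proof -
  have "slope_to_head f e t \<le> slope_to_head g e t" "slope_to_tail f e t \<le> slope_to_tail g e t"
    using slope_to_head_mono[OF fg(1,2) e] slope_to_tail_mono[OF fg(1,2) e] fg(3) t eq by auto
  with ord show "slope_to_head f e t = slope_to_head g e t" "slope_to_tail f e t = slope_to_tail g e t"
    by auto
qed

text \<open>Between tail and \<open>x\<close>, the set where \<open>f\<close> and \<open>g\<close>
  touch is closed by continuity and open towards the tail, because equal slopes at a contact point
  make both the same affine function nearby.\<close>

lemma contact_reaches_tail:
  assumes fg: "rational_function f" "rational_function g" "\<And>p. f p \<le> g p"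
    and e: "e \<in> arcs G" and x: "0 < x" "x < len e"
    and eq: "f (on_edge e x) = g (on_edge e x)"
    and ord: "\<And>t. 0 < t \<Longrightarrow> t \<le> x \<Longrightarrow> ord_at (Inner e t) g \<le> ord_at (Inner e t) f"
  shows "f (Vertex (tail G e)) = g (Vertex (tail G e))"
proof -
  have "f (on_edge e 0) = g (on_edge e 0)"
  proof (rule interval_descent[of x])
    fix u assume u: "0 \<le> u" "u < x" and above: "\<And>s. u < s \<Longrightarrow> s \<le> x \<Longrightarrow> f (on_edge e s) = g (on_edge e s)"
    show "f (on_edge e u) = g (on_edge e u)"
      using has_initial_slope_eq_0[OF has_slope_to_head[OF fg(1) e] has_slope_to_head[OF fg(2) e],
          of u u "x - u"] u x above by simp
  next
    fix u assume u: "0 < u" "u \<le> x" and eq: "f (on_edge e u) = g (on_edge e u)"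
    have "slope_to_tail f e u = slope_to_tail g e u"
      using contact_slopes_eq(2)[OF fg e _ _ eq] ord u x by simp
    then have "has_initial_slope (\<lambda>s. f (on_edge e (u - s))) (slope_to_tail g e u)"
        "has_initial_slope (\<lambda>s. g (on_edge e (u - s))) (slope_to_tail g e u)"
      using has_slope_to_tail[OF fg(1) e, of u] has_slope_to_tail[OF fg(2) e, of u] u x by auto
    then obtain \<delta>1 \<delta>2 where \<delta>: "0 < \<delta>1" "0 < \<delta>2"
      "\<And>s. 0 \<le> s \<Longrightarrow> s \<le> \<delta>1 \<Longrightarrow> f (on_edge e (u - s)) = f (on_edge e u) + of_int (slope_to_tail g e u) * s"
      "\<And>s. 0 \<le> s \<Longrightarrow> s \<le> \<delta>2 \<Longrightarrow> g (on_edge e (u - s)) = g (on_edge e u) + of_int (slope_to_tail g e u) * s"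
      by (elim has_initial_slopeE) simp
    show "\<exists>\<delta>>0. \<forall>s. u - \<delta> \<le> s \<longrightarrow> s \<le> u \<longrightarrow> f (on_edge e s) = g (on_edge e s)"
    proof (intro exI[of _ "min \<delta>1 \<delta>2"] conjI allI impI)
      fix s assume "u - min \<delta>1 \<delta>2 \<le> s" "s \<le> u"
      then show "f (on_edge e s) = g (on_edge e s)"
        using \<delta>(3)[of "u - s"] \<delta>(4)[of "u - s"] eq by simp
    qed (use \<delta> in simp)
  qed (use x eq in auto)
  then show ?thesis by simp
qed

text \<open>The mirror image: \<open>?o\<close> measures distance from the head, which exchanges the
  two directions on \<open>e\<close>.\<close>

lemma contact_reaches_head:
  assumes fg: "rational_function f" "rational_function g" "\<And>p. f p \<le> g p"
    and e: "e \<in> arcs G" and x: "0 < x" "x < len e"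
    and eq: "f (on_edge e x) = g (on_edge e x)"
    and ord: "\<And>t. x \<le> t \<Longrightarrow> t < len e \<Longrightarrow> ord_at (Inner e t) g \<le> ord_at (Inner e t) f"
  shows "f (Vertex (head G e)) = g (Vertex (head G e))"
proof -
  let ?o = "\<lambda>s. on_edge e (len e - s)"
  have "f (?o 0) = g (?o 0)"
  proof (rule interval_descent[of "len e - x"])
    fix u assume u: "0 \<le> u" "u < len e - x" and above: "\<And>s. u < s \<Longrightarrow> s \<le> len e - x \<Longrightarrow> f (?o s) = g (?o s)"
    have "f (on_edge e (len e - u - s)) = g (on_edge e (len e - u - s))"
      if "0 < s" "s \<le> len e - x - u" for s
      using above[of "u + s"] that by (simp add: algebra_simps)
    then show "f (?o u) = g (?o u)"
      using has_initial_slope_eq_0[OF has_slope_to_tail[OF fg(1) e] has_slope_to_tail[OF fg(2) e],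
          of "len e - u" "len e - u" "len e - x - u"] u x by simp
  next
    fix u assume u: "0 < u" "u \<le> len e - x" and eq: "f (?o u) = g (?o u)"
    let ?t = "len e - u"
    have "slope_to_head f e ?t = slope_to_head g e ?t"
      using contact_slopes_eq(1)[OF fg e _ _ eq] ord u x by simp
    then have "has_initial_slope (\<lambda>s. f (on_edge e (?t + s))) (slope_to_head g e ?t)"
        "has_initial_slope (\<lambda>s. g (on_edge e (?t + s))) (slope_to_head g e ?t)"
      using has_slope_to_head[OF fg(1) e, of ?t] has_slope_to_head[OF fg(2) e, of ?t] u x by auto
    then obtain \<delta>1 \<delta>2 where \<delta>: "0 < \<delta>1" "0 < \<delta>2"
      "\<And>s. 0 \<le> s \<Longrightarrow> s \<le> \<delta>1 \<Longrightarrow> f (on_edge e (?t + s)) = f (on_edge e ?t) + of_int (slope_to_head g e ?t) * s"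
      "\<And>s. 0 \<le> s \<Longrightarrow> s \<le> \<delta>2 \<Longrightarrow> g (on_edge e (?t + s)) = g (on_edge e ?t) + of_int (slope_to_head g e ?t) * s"
      by (elim has_initial_slopeE) simp
    show "\<exists>\<delta>>0. \<forall>s. u - \<delta> \<le> s \<longrightarrow> s \<le> u \<longrightarrow> f (?o s) = g (?o s)"
    proof (intro exI[of _ "min \<delta>1 \<delta>2"] conjI allI impI)
      fix s assume "u - min \<delta>1 \<delta>2 \<le> s" "s \<le> u"
      then show "f (?o s) = g (?o s)"
        using \<delta>(3)[of "u - s"] \<delta>(4)[of "u - s"] eq by simp
    qed (use \<delta> in simp)
  qed (use x eq in auto)
  then show ?thesis using e by simp
qed

text \<open>For \<open>D\<close> and \<open>q\<close> supported on points of the graph this says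
  that \<open>|D - q|\<close> is non-empty. The pointwise form allows work with functions instead of
  finitely supported maps.\<close>

definition reaches :: "('a, 'b) point divisor \<Rightarrow> ('a, 'b) point \<Rightarrow> bool" where
  "reaches D q \<longleftrightarrow> (\<exists>f. rational_function f \<and>
     (\<forall>p\<in>points. of_bool (p = q) \<le> Poly_Mapping.lookup D p + ord_at p f))"

text \<open>Constants have divisor zero, so a witness may be shifted to vanish at a prescribed
  \<open>x\<close>; two witnesses then touch there.\<close>

lemma reaches_normalized:
  assumes "reaches D q"
  obtains f where "rational_function f" "f x = 0"
    "\<And>p. p \<in> points \<Longrightarrow> of_bool (p = q) \<le> Poly_Mapping.lookup D p + ord_at p f"
proof -
  obtain f where f: "rational_function f"
    "\<And>p. p \<in> points \<Longrightarrow> of_bool (p = q) \<le> Poly_Mapping.lookup D p + ord_at p f"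
    using assms by (auto simp: reaches_def)
  show thesis
  proof
    show "rational_function (\<lambda>p. f p + (- f x))"
      by (intro rational_function_add f rational_function_const)
    show "f x + (- f x) = 0" by simp
    show "of_bool (p = q) \<le> Poly_Mapping.lookup D p + ord_at p (\<lambda>p. f p + (- f x))"
      if "p \<in> points" for p
      using f(2)[OF that] ord_at_add[OF f(1) rational_function_const that]
      by (simp only: ord_at_const)
  qed
qed

end

section \<open>From the two ends of an edge to its interior\<close>

context loopless_metric_graph
begin

lemma reaches_Inner:
  assumes e: "e \<in> arcs G" and x: "0 < x" "x < len e"
    and tail: "reaches D (Vertex (tail G e))" and head: "reaches D (Vertex (head G e))"
  shows "reaches D (Inner e x)"
proof -
  let ?D = "Poly_Mapping.lookup D"
  obtain f1 where f1: "rational_function f1" "f1 (Inner e x) = 0"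
    "\<And>p. p \<in> points \<Longrightarrow> of_bool (p = Vertex (tail G e)) \<le> ?D p + ord_at p f1"
    using reaches_normalized[OF tail, of "Inner e x"] by blast
  obtain f2 where f2: "rational_function f2" "f2 (Inner e x) = 0"
    "\<And>p. p \<in> points \<Longrightarrow> of_bool (p = Vertex (head G e)) \<le> ?D p + ord_at p f2"
    using reaches_normalized[OF head, of "Inner e x"] by blast
  define g where "g = (\<lambda>p. max (f1 p) (f2 p))"
  have g: "rational_function g" "f1 p \<le> g p" "f2 p \<le> g p" "g (Inner e x) = 0" for p
    using f1 f2 by (auto simp: g_def intro: rational_function_max)
  have ox: "on_edge e x = Inner e x"
    using x by (rule on_edge_Inner)
  have nonneg: "0 \<le> ?D p + ord_at p f1" "0 \<le> ?D p + ord_at p f2" if "p \<in> points" for p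
    using f1(3)[OF that] f2(3)[OF that] by (auto intro: order_trans[rotated])
  \<comment> \<open>The coefficients of \<open>D + div g\<close>, the divisor to be
    corrected.\<close>
  define N where "N p = ?D p + ord_at p g" for p
  have N: "0 \<le> N p" if "p \<in> points" for p
    using ord_at_max_ge[OF f1(1) f2(1) that] nonneg[OF that] by (auto simp: N_def g_def)
  show ?thesis
  proof (cases "N (Inner e x) = 0")
    case False
    have "of_bool (p = Inner e x) \<le> ?D p + ord_at p g" if "p \<in> points" for p
      using N[OF that] False by (cases "p = Inner e x") (auto simp: N_def simp del: ord_at.simps)
    then show ?thesis
      unfolding reaches_def using g(1) by blast
  next
    case Nx: True
    have pts: "on_edge e t \<in> points" if "0 \<le> t" "t \<le> len e" for t
      using on_edge_in_points e that by blast
    have "\<exists>a\<ge>0. a < x \<and> N (on_edge e a) \<noteq> 0"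
    proof (rule ccontr)
      assume "\<not> ?thesis"
      then have zero: "N (on_edge e t) = 0" if "0 \<le> t" "t \<le> x" for t
        using that Nx ox by (cases "t = x") auto
      have "f1 (Vertex (tail G e)) = g (Vertex (tail G e))"
      proof (rule contact_reaches_tail[OF f1(1) g(1,2) e x])
        \<comment> \<open>At a point without chips \<open>?D + ord g = 0\<close>, which is at most
          \<open>?D + ord f1\<close>: absence of chips is thus the inequality that the contact
          argument asks for.\<close>
        show "ord_at (Inner e t) g \<le> ord_at (Inner e t) f1" if "0 < t" "t \<le> x" for t
          using zero[of t] nonneg(1)[OF pts, of t] that x
          by (simp add: on_edge_Inner N_def del: ord_at.simps)
      qed (use ox f1 g in simp)
      then have "ord_at (Vertex (tail G e)) f1 \<le> ord_at (Vertex (tail G e)) g"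
        using ord_at_mono[OF f1(1) g(1) _ _ g(2)] pts[of 0] x by (simp del: ord_at.simps)
      then show False
        using zero[of 0] f1(3)[OF pts, of 0] x by (simp add: N_def del: ord_at.simps)
    qed
    then obtain a where a: "0 \<le> a" "a < x" "N (on_edge e a) \<noteq> 0" by blast
    have "\<exists>b>x. b \<le> len e \<and> N (on_edge e b) \<noteq> 0"
    proof (rule ccontr)
      assume "\<not> ?thesis"
      then have zero: "N (on_edge e t) = 0" if "x \<le> t" "t \<le> len e" for t
        using that Nx ox by (cases "t = x") auto
      have "f2 (Vertex (head G e)) = g (Vertex (head G e))"
      proof (rule contact_reaches_head[OF f2(1) g(1,3) e x])
        show "ord_at (Inner e t) g \<le> ord_at (Inner e t) f2" if "x \<le> t" "t < len e" for t
          using zero[of t] nonneg(2)[OF pts, of t] that x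
          by (simp add: on_edge_Inner N_def del: ord_at.simps)
      qed (use ox f2 g in simp)
      then have "ord_at (Vertex (head G e)) f2 \<le> ord_at (Vertex (head G e)) g"
        using ord_at_mono[OF f2(1) g(1) _ _ g(3)] pts[of "len e"] x e by (simp del: ord_at.simps)
      then show False
        using zero[of "len e"] f2(3)[OF pts, of "len e"] x e by (simp add: N_def del: ord_at.simps)
    qed
    then obtain b where b: "x < b" "b \<le> len e" "N (on_edge e b) \<noteq> 0" by blast
    \<comment> \<open>Taking the smaller distance makes \<open>x\<close> a bottom corner of the
      trough and leaves enough room on the other side for \<open>a + 2 * d \<le> b\<close>.\<close>
    define d where "d = min (x - a) (b - x)"
    have d: "0 < d" "a + 2 * d \<le> b" "x = a + d \<or> x = b - d"
      using a b by (auto simp: d_def min_def)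
    let ?h = "edge_trough e a b d"
    have h: "rational_function ?h"
      using a b d by (intro rational_function_edge_trough) auto
    \<comment> \<open>Looplessness enters here: for \<open>a = 0\<close> and
      \<open>b = len e\<close> the two ends of a loop would be one vertex, which would owe two chips
      while only one is known to lie there.\<close>
    have ab: "on_edge e a \<noteq> on_edge e b"
      using a b no_loops[OF e] by (auto simp: on_edge_def)
    have chips: "1 \<le> N (on_edge e a)" "1 \<le> N (on_edge e b)"
      using a b x N[OF pts, of a] N[OF pts, of b] by auto
    have "of_bool (p = Inner e x) \<le> ?D p + ord_at p (\<lambda>p. g p + ?h p)" if p: "p \<in> points" for p
    proof -
      have "of_bool (p = on_edge e a) + of_bool (p = on_edge e b) \<le> N p"
        using ab chips N[OF p] by auto
      moreover have "of_bool (p = Inner e x) - of_bool (p = on_edge e a) - of_bool (p = on_edge e b)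
          \<le> ord_at p ?h"
        using a b d p by (intro ord_at_edge_trough e) auto
      ultimately show ?thesis
        unfolding ord_at_add[OF g(1) h p] N_def by linarith
    qed
    then show ?thesis
      unfolding reaches_def using rational_function_add[OF g(1) h] by blast
  qed
qed

end

subsection \<open>Replacing inner points by vertices\<close>

text \<open>With the complement of the vertices as \<open>A\<close> this counts inner chips with
  multiplicity, the induction measure below; with \<open>UNIV\<close> it is the degree.\<close>

definition degree_on :: "'p set \<Rightarrow> 'p divisor \<Rightarrow> int" where
  "degree_on A D = (\<Sum>v\<in>Poly_Mapping.keys D \<inter> A. Poly_Mapping.lookup D v)"

lemma degree_eq_degree_on_UNIV: "degree D = degree_on UNIV D"
  by (simp add: degree_def degree_on_def)

lemma degree_on_add: "degree_on A (D + E) = degree_on A D + degree_on A E"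
proof -
  \<comment> \<open>A common finite index set, as cancellation may make the support of
    \<open>D + E\<close> smaller than the union.\<close>
  let ?S = "(Poly_Mapping.keys D \<union> Poly_Mapping.keys E) \<inter> A"
  have *: "degree_on A F = (\<Sum>v\<in>?S. Poly_Mapping.lookup F v)"
    if "Poly_Mapping.keys F \<subseteq> Poly_Mapping.keys D \<union> Poly_Mapping.keys E" for F
    unfolding degree_on_def using that
    by (intro sum.mono_neutral_left) (auto simp: in_keys_iff)
  show ?thesis
    using *[of D] *[of E] *[OF keys_add] by (simp add: lookup_add sum.distrib)
qed

lemma degree_on_single: "degree_on A (Poly_Mapping.single p k) = (if p \<in> A then k else 0)"
  by (auto simp: degree_on_def)

lemma effective_degree_on_nonneg: "effective D \<Longrightarrow> 0 \<le> degree_on A D"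
  by (auto simp: effective_def degree_on_def intro: sum_nonneg)

lemma effective_degree_on_eq_0:
  assumes "effective D" "degree_on A D = 0"
  shows "Poly_Mapping.keys D \<inter> A = {}"
proof -
  have "\<forall>v\<in>Poly_Mapping.keys D \<inter> A. Poly_Mapping.lookup D v = 0"
    using assms by (subst sum_nonneg_eq_0_iff[symmetric]) (auto simp: effective_def degree_on_def)
  then show ?thesis by (auto simp: in_keys_iff)
qed

lemma in_Div_iff: "D \<in> Div A \<longleftrightarrow> Poly_Mapping.keys D \<subseteq> A"
  by (simp add: Div_def)

lemma Div_add: "D \<in> Div A \<Longrightarrow> E \<in> Div A \<Longrightarrow> D + E \<in> Div A"
  unfolding in_Div_iff using keys_add[of D E] by blast

lemma Div_diff: "D \<in> Div A \<Longrightarrow> E \<in> Div A \<Longrightarrow> D - E \<in> Div A"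
  unfolding in_Div_iff using keys_diff[of D E] by blast

lemma Div_single: "p \<in> A \<Longrightarrow> Poly_Mapping.single p k \<in> Div A"
  by (simp add: in_Div_iff)

lemma Div_mono: "A \<subseteq> B \<Longrightarrow> Div A \<subseteq> Div B"
  by (auto simp: in_Div_iff)

lemma effective_add: "effective D \<Longrightarrow> effective E \<Longrightarrow> effective (D + E)"
  by (simp add: effective_def lookup_add)

lemma effective_single: "0 \<le> k \<Longrightarrow> effective (Poly_Mapping.single p k)"
  by (simp add: effective_def lookup_single when_def)

context metric_graph
begin

text \<open>Outside of \<open>points\<close> the divisors \<open>D\<close>, \<open>q\<close> and
  \<open>div f\<close> all vanish, so \<open>D - q + div f\<close> lies in \<open>Div points\<close>
  and its effectiveness is decided on \<open>points\<close>.\<close>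

lemma linear_system_nonempty_iff_reaches:
  assumes "D \<in> Div points" "q \<in> points"
  shows "linear_system (D - Poly_Mapping.single q 1) \<noteq> {} \<longleftrightarrow> reaches D q"
proof -
  have *: "effective (D - Poly_Mapping.single q 1 + divisor_of f) \<longleftrightarrow>
      (\<forall>p\<in>points. of_bool (p = q) \<le> Poly_Mapping.lookup D p + ord_at p f)"
    if "rational_function f" for f
  proof -
    have "Poly_Mapping.lookup D p = 0" if "p \<notin> points" for p
      using assms(1) that by (auto simp: in_Div_iff in_keys_iff)
    then show ?thesis
      using assms(2) that unfolding effective_def
      by (auto simp: lookup_add lookup_minus lookup_single lookup_divisor_of when_def of_bool_def
        simp del: ord_at.simps split: if_splits)
  qed
  have "divisor_of f \<in> Div points" if "rational_function f" for f
    using that by (auto simp: in_Div_iff in_keys_iff lookup_divisor_of split: if_splits simp del: ord_at.simps)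
  then have "D - Poly_Mapping.single q 1 + divisor_of f \<in> Div points" if "rational_function f" for f
    using that assms by (intro Div_add Div_diff Div_single) auto
  then show ?thesis
    unfolding linear_system_def equivalent_def reaches_def using * by blast
qed

lemma branching_points_subset: "branching_points \<subseteq> points"
  by (auto simp: branching_points_def points_def)

lemma branching_points_nonempty: "branching_points \<noteq> {}"
  using connected_graph
  by (simp add: branching_points_def Digraph_Component.connected_def strongly_connected_def)

end

section \<open>The exchange of inner chips and the equality of ranks\<close>

context loopless_metric_graph
begin

text \<open>Induction on the number of inner chips of \<open>E\<close>. Trading one inner chip for
  an end of its edge keeps the degree \<open>k\<close> and lowers this number, so the induction
  hypothesis applies to both ends, and \<open>reaches_Inner\<close> leads back to the inner
  point.\<close>

lemma linear_system_nonempty_if_branching: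
  assumes D: "D \<in> Div points"
    and B: "\<And>E. E \<in> Div branching_points \<Longrightarrow> effective E \<Longrightarrow> degree E = k \<Longrightarrow> linear_system (D - E) \<noteq> {}"
    and E: "E \<in> Div points" "effective E" "degree E = k"
  shows "linear_system (D - E) \<noteq> {}"
proof -
  let ?inner = "degree_on (- branching_points)"
  have "linear_system (D - E) \<noteq> {}" if "?inner E = int n" for n
    using that E
  proof (induction n arbitrary: E)
    case 0
    \<comment> \<open>For an effective divisor, inner degree zero excludes cancellation, so the
      support consists of vertices.\<close>
    then have "E \<in> Div branching_points"
      using effective_degree_on_eq_0[of E "- branching_points"] by (auto simp: in_Div_iff)
    with 0 show ?case by (intro B)
  next
    case (Suc n)
    then have "Poly_Mapping.keys E \<inter> - branching_points \<noteq> {}"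
      by (auto simp: degree_on_def)
    then obtain p where p: "p \<in> Poly_Mapping.keys E" "p \<notin> branching_points" by blast
    then have pp: "p \<in> points" using Suc.prems by (auto simp: in_Div_iff)
    then obtain e x where e: "p = Inner e x" "e \<in> arcs G" "0 < x" "x < len e"
      using p(2) by (auto simp: points_def branching_points_def)
    define E0 where "E0 = E - Poly_Mapping.single p 1"
    have E_eq: "E = E0 + Poly_Mapping.single p 1" by (simp add: E0_def)
    have E0: "E0 \<in> Div points"
      unfolding E0_def using Suc.prems pp by (intro Div_diff Div_single)
    have "0 < Poly_Mapping.lookup E p"
      using p(1) Suc.prems(3) by (simp add: effective_def in_keys_iff order_less_le)
    then have eff: "effective E0"
      using Suc.prems(3) by (auto simp: effective_def E0_def lookup_minus lookup_single when_def)
    have vertex: "reaches (D - E0) (Vertex v)" if v: "v \<in> verts G" for v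
    proof -
      let ?E = "E0 + Poly_Mapping.single (Vertex v) 1"
      have vB: "Vertex v \<in> branching_points" using v by (simp add: branching_points_def)
      have "linear_system (D - ?E) \<noteq> {}"
      proof (rule Suc.IH)
        show "?inner ?E = int n"
          using Suc.prems(1) vB p(2) unfolding E_eq by (simp add: degree_on_add degree_on_single)
        show "?E \<in> Div points"
          using E0 vB branching_points_subset by (intro Div_add Div_single) auto
        show "effective ?E"
          using eff by (intro effective_add effective_single) auto
        show "degree ?E = k"
          using Suc.prems(4) unfolding E_eq
          by (simp add: degree_eq_degree_on_UNIV degree_on_add degree_on_single)
      qed
      moreover have "D - ?E = D - E0 - Poly_Mapping.single (Vertex v) 1" by simp
      ultimately show ?thesis
        using linear_system_nonempty_iff_reaches[OF Div_diff[OF D E0]] vB branching_points_subset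
        by (metis subsetD)
    qed
    have "reaches (D - E0) p"
      unfolding e(1) using e by (intro reaches_Inner vertex) auto
    then have "linear_system (D - E0 - Poly_Mapping.single p 1) \<noteq> {}"
      using linear_system_nonempty_iff_reaches[OF Div_diff[OF D E0] pp] by simp
    then show ?case by (simp add: E_eq diff_diff_eq)
  qed
  then show ?thesis
    using nonneg_int_cases[OF effective_degree_on_nonneg[OF E(2), of "- branching_points"]] by blast
qed

theorem rank_determining_branching_points: "rank_determining branching_points"
proof -
  have "rank D = restricted_rank branching_points D" if D: "D \<in> Div points" for D
  proof -
    \<comment> \<open>The two sets of degrees coincide, so \<open>LEAST\<close> selects the same
      number from both.\<close>
    have "k \<in> {degree E |E. E \<in> Div points \<and> effective E \<and> linear_system (D - E) = {}} \<longleftrightarrow>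
        k \<in> {degree E |E. E \<in> Div branching_points \<and> effective E \<and> linear_system (D - E) = {}}"
      (is "k \<in> ?S \<longleftrightarrow> k \<in> ?T") for k
    proof
      assume "k \<in> ?S"
      then obtain E where "E \<in> Div points" "effective E" "degree E = k" "linear_system (D - E) = {}"
        by auto
      \<comment> \<open>Contraposition at a fixed degree: if no effective divisor of degree
        \<open>k\<close> on the vertices emptied the linear system, then no effective divisor of
        degree \<open>k\<close> would.\<close>
      then show "k \<in> ?T"
        using linear_system_nonempty_if_branching[OF D, of k E] by fastforce
    next
      assume "k \<in> ?T"
      then show "k \<in> ?S"
        using Div_mono[OF branching_points_subset] by auto
    qed
    then show ?thesis
      by (simp only: rank_def restricted_rank_def)
  qed
  then show ?thesis
    unfolding rank_determining_def
    using branching_points_nonempty branching_points_subset by blast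
qed

end

theorem theorem1p7:
  fixes G :: "('a, 'b) pre_digraph" and len :: "'b \<Rightarrow> real"
  assumes "loopless_metric_graph G len"
  shows "metric_graph.rank_determining G len (metric_graph.branching_points G)"
  using loopless_metric_graph.rank_determining_branching_points[OF assms] .

end
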